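(* Let $R$ be a commutative ring, let $\mathcal M$, $\mathcal P$, $\mathcal P'$ satisfy conditions (1)–(5) of the context, and let $p$ be a functorial pair operation defined on $\mathcal P$. Then one can define a hereditary, functorial pair operation $p_{\mathrm h}$ on $\mathcal P'$ as follows: for $(A,B)\in\mathcal P'$, let $i:B\to E$ be a monomorphism in $\mathcal M$ with $E$ injective and $(i(A),E)\in\mathcal P$, and set $$p_{\mathrm h}(A,B):=i^{-1}(p(i(A),E)).$$ (In particular this is independent of the choice of $i$ and $E$.) Viewing $i$ as an inclusion map, this equals $p(A,E)\cap B$. Moreover, if $p$ is a hereditary, functorial pair operation defined on $\mathcal P'$, then $p_{\mathrm h}=p$.
   Context: Setting: (1) $\mathcal M$ is an abelian category of $R$-modules (and $R$-linear maps) that has enough injectives. Submodule inclusions, quotient maps, kernels, images and cokernels in $\mathcal M$ are the usual module-theoretic ones; "injective module" means injective in $\mathcal M$ (e.g. graded injective if $\mathcal M$ consists of graded modules); all homomorphisms are morphisms of $\mathcal M$. (2) $\mathcal P$ is a set of pairs $(C,E)$ with $C\subseteq E$, $C,E\in\mathcal M$, and $E$ injective. (3) $\mathcal P'$ is a set of pairs $(A,B)$ of modules in $\mathcal M$ with $A\subseteq B$ such that $\mathcal P\subseteq\mathcal P'$ and for every $(A,B)\in\mathcal P'$ there are an injective module $E$ and an injection $i:B\to E$ in $\mathcal M$ with $(i(A),E)\in\mathcal P$. (4) If $(A,B),(C,B)\in\mathcal P'$ with $A\subseteq C$, there are an injective module $E$ and an injection $i:B\to E$ in $\mathcal M$ such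 that $(i(A),E),(i(C),E)\in\mathcal P$. (5) Given $A,B,E,i$ as in (3), if $\psi:B\to C$ is an injection in $\mathcal M$, $j:C\hookrightarrow F$ is an injection in $\mathcal M$ into an injective module $F$ with $(j(\psi(A)),F)\in\mathcal P$, and $\tilde\psi:E\to F$ is any map in $\mathcal M$ with $\tilde\psi\circ i=j\circ\psi$, then $(\tilde\psi^{-1}(j(\psi(A))),E)\in\mathcal P$. Both $\mathcal P$ and $\mathcal P'$ are closed under isomorphism: if $(L,M)$ is in the class and $\phi:M\to M'$ is an isomorphism in $\mathcal M$, then $(\phi(L),M')$ is in the class. A pair operation on such a class is a function $p$ sending each pair $(L,M)$ in it to a submodule $p(L,M)$ of $M$ with $\phi(p(L,M))=p(\phi(L),M')$ for every isomorphism $\phi:M\to M'$ in $\mathcal M$. It is functorial if $g(p(L,M))\subseteq p(g(L),M')$ whenever $g:M\to M'$ is in $\mathcal M$ and $(L,M),(g(L),M')$ are in the class; it is hereditary if $p(L,N)=p(L,M)\cap N$ whenever $L\subseteq N\subseteq M$ and $(L,M),(L,N)$ are in the class. *)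

theory Defs
  imports "HOL-Algebra.Module" "HOL-Library.FuncSet"
begin

section \<open>Categories of modules\<close>

text \<open>
  A category of modules consists of a collection of modules and, for any two of them, a set of
  maps between them.  It need not be a full subcategory of the category of all modules: extra
  structure on the objects (such as a grading) can be kept in the \<open>more\<close> part of the
  module record, and \<open>mor\<close> then selects the maps respecting it.  Morphisms are linear
  maps made extensional, so that equality of morphisms is HOL equality, composition in the
  category is \<^const>\<open>compose\<close> and the identity of \<open>M\<close> is \<open>\<lambda>x\<in>carrier M. x\<close>.
\<close>

record ('r, 'm, 'z) modcat =
  obj :: "('r, 'm, 'z) module_scheme set"
  mor :: "('r, 'm, 'z) module_scheme \<Rightarrow> ('r, 'm, 'z) module_scheme \<Rightarrow> ('m \<Rightarrow> 'm) set"

definition linear_maps ::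
  "('r, 's) ring_scheme \<Rightarrow> ('r, 'm, 'z) module_scheme \<Rightarrow> ('r, 'm, 'z) module_scheme
    \<Rightarrow> ('m \<Rightarrow> 'm) set" where
  "linear_maps R M N = {f \<in> carrier M \<rightarrow>\<^sub>E carrier N.
     (\<forall>x\<in>carrier M. \<forall>y\<in>carrier M. f (x \<oplus>\<^bsub>M\<^esub> y) = f x \<oplus>\<^bsub>N\<^esub> f y) \<and>
     (\<forall>r\<in>carrier R. \<forall>x\<in>carrier M. f (r \<odot>\<^bsub>M\<^esub> x) = r \<odot>\<^bsub>N\<^esub> f x)}"

locale module_category =
  fixes R :: "('r, 's) ring_scheme" and C :: "('r, 'm, 'z) modcat"
  assumes ring: "cring R"
    and obj_module: "M \<in> obj C \<Longrightarrow> module R M"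
    and mor_linear: "\<lbrakk>M \<in> obj C; N \<in> obj C\<rbrakk> \<Longrightarrow> mor C M N \<subseteq> linear_maps R M N"
    and id_mor: "M \<in> obj C \<Longrightarrow> (\<lambda>x\<in>carrier M. x) \<in> mor C M M"
    and comp_mor: "\<lbrakk>L \<in> obj C; M \<in> obj C; N \<in> obj C; f \<in> mor C L M; g \<in> mor C M N\<rbrakk>
      \<Longrightarrow> compose (carrier L) g f \<in> mor C L N"

definition zero_map ::
  "('r, 'm, 'z) module_scheme \<Rightarrow> ('r, 'm, 'z) module_scheme \<Rightarrow> 'm \<Rightarrow> 'm" where
  "zero_map M N = (\<lambda>x\<in>carrier M. \<zero>\<^bsub>N\<^esub>)"

definition is_mono ::
  "('r, 'm, 'z) modcat \<Rightarrow> ('r, 'm, 'z) module_scheme \<Rightarrow> ('r, 'm, 'z) module_scheme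
    \<Rightarrow> ('m \<Rightarrow> 'm) \<Rightarrow> bool" where
  "is_mono C M N f \<longleftrightarrow> f \<in> mor C M N \<and>
     (\<forall>X\<in>obj C. \<forall>g\<in>mor C X M. \<forall>h\<in>mor C X M.
        compose (carrier X) f g = compose (carrier X) f h \<longrightarrow> g = h)"

definition is_epi ::
  "('r, 'm, 'z) modcat \<Rightarrow> ('r, 'm, 'z) module_scheme \<Rightarrow> ('r, 'm, 'z) module_scheme
    \<Rightarrow> ('m \<Rightarrow> 'm) \<Rightarrow> bool" where
  "is_epi C M N f \<longleftrightarrow> f \<in> mor C M N \<and>
     (\<forall>X\<in>obj C. \<forall>g\<in>mor C N X. \<forall>h\<in>mor C N X.
        compose (carrier M) g f = compose (carrier M) h f \<longrightarrow> g = h)"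

definition is_iso ::
  "('r, 'm, 'z) modcat \<Rightarrow> ('r, 'm, 'z) module_scheme \<Rightarrow> ('r, 'm, 'z) module_scheme
    \<Rightarrow> ('m \<Rightarrow> 'm) \<Rightarrow> bool" where
  "is_iso C M N f \<longleftrightarrow> f \<in> mor C M N \<and>
     (\<exists>g\<in>mor C N M. compose (carrier M) g f = (\<lambda>x\<in>carrier M. x) \<and>
                    compose (carrier N) f g = (\<lambda>x\<in>carrier N. x))"

text \<open>\<open>k: K \<rightarrow> M\<close> is a categorical kernel of \<open>f: M \<rightarrow> N\<close>.\<close>

definition is_kernel ::
  "('r, 'm, 'z) modcat \<Rightarrow> ('r, 'm, 'z) module_scheme \<Rightarrow> ('r, 'm, 'z) module_scheme
    \<Rightarrow> ('m \<Rightarrow> 'm) \<Rightarrow> ('r, 'm, 'z) module_scheme \<Rightarrow> ('m \<Rightarrow> 'm) \<Rightarrow> bool" where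
  "is_kernel C M N f K k \<longleftrightarrow> K \<in> obj C \<and> k \<in> mor C K M \<and>
     compose (carrier K) f k = zero_map K N \<and>
     (\<forall>X\<in>obj C. \<forall>h\<in>mor C X M. compose (carrier X) f h = zero_map X N \<longrightarrow>
        (\<exists>!u. u \<in> mor C X K \<and> compose (carrier X) k u = h))"

text \<open>\<open>q: N \<rightarrow> Q\<close> is a categorical cokernel of \<open>f: M \<rightarrow> N\<close>.\<close>

definition is_cokernel ::
  "('r, 'm, 'z) modcat \<Rightarrow> ('r, 'm, 'z) module_scheme \<Rightarrow> ('r, 'm, 'z) module_scheme
    \<Rightarrow> ('m \<Rightarrow> 'm) \<Rightarrow> ('r, 'm, 'z) module_scheme \<Rightarrow> ('m \<Rightarrow> 'm) \<Rightarrow> bool" where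
  "is_cokernel C M N f Q q \<longleftrightarrow> Q \<in> obj C \<and> q \<in> mor C N Q \<and>
     compose (carrier M) q f = zero_map M Q \<and>
     (\<forall>X\<in>obj C. \<forall>h\<in>mor C N X. compose (carrier M) h f = zero_map M X \<longrightarrow>
        (\<exists>!u. u \<in> mor C Q X \<and> compose (carrier N) u q = h))"

definition is_zero_obj :: "('r, 'm, 'z) modcat \<Rightarrow> ('r, 'm, 'z) module_scheme \<Rightarrow> bool" where
  "is_zero_obj C Z \<longleftrightarrow> Z \<in> obj C \<and>
     (\<forall>M\<in>obj C. (\<exists>!f. f \<in> mor C Z M) \<and> (\<exists>!f. f \<in> mor C M Z))"

definition is_biproduct ::
  "('r, 'm, 'z) modcat \<Rightarrow> ('r, 'm, 'z) module_scheme \<Rightarrow> ('r, 'm, 'z) module_scheme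
    \<Rightarrow> ('r, 'm, 'z) module_scheme \<Rightarrow> ('m \<Rightarrow> 'm) \<Rightarrow> ('m \<Rightarrow> 'm) \<Rightarrow> ('m \<Rightarrow> 'm) \<Rightarrow> ('m \<Rightarrow> 'm)
    \<Rightarrow> bool" where
  "is_biproduct C M N S i j p q \<longleftrightarrow> S \<in> obj C \<and>
     i \<in> mor C M S \<and> j \<in> mor C N S \<and> p \<in> mor C S M \<and> q \<in> mor C S N \<and>
     compose (carrier M) p i = (\<lambda>x\<in>carrier M. x) \<and>
     compose (carrier N) q j = (\<lambda>x\<in>carrier N. x) \<and>
     compose (carrier M) q i = zero_map M N \<and>
     compose (carrier N) p j = zero_map N M \<and>
     (\<lambda>x\<in>carrier S. i (p x) \<oplus>\<^bsub>S\<^esub> j (q x)) = (\<lambda>x\<in>carrier S. x)"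

text \<open>
  The morphism sets are subgroups of the groups of linear maps under pointwise addition; they
  need not be closed under multiplication by scalars (degree-preserving maps of graded modules
  over a graded ring are not).  The assumptions \<open>kernels\<close> and \<open>cokernels\<close> say that
  kernels and cokernels exist and that they are the module-theoretic ones: the kernel of
  \<open>f\<close> is carried by the set of elements killed by \<open>f\<close>, and a cokernel of \<open>f\<close>
  is a surjection whose module-theoretic kernel is the image of \<open>f\<close>.  The last two
  assumptions say that every monomorphism is a kernel and every epimorphism a cokernel.
\<close>

locale abelian_module_category = module_category +
  assumes zero_mor: "\<lbrakk>M \<in> obj C; N \<in> obj C\<rbrakk> \<Longrightarrow> zero_map M N \<in> mor C M N"
    and add_mor: "\<lbrakk>M \<in> obj C; N \<in> obj C; f \<in> mor C M N; g \<in> mor C M N\<rbrakk>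
      \<Longrightarrow> (\<lambda>x\<in>carrier M. f x \<oplus>\<^bsub>N\<^esub> g x) \<in> mor C M N"
    and minus_mor: "\<lbrakk>M \<in> obj C; N \<in> obj C; f \<in> mor C M N\<rbrakk>
      \<Longrightarrow> (\<lambda>x\<in>carrier M. \<ominus>\<^bsub>N\<^esub> f x) \<in> mor C M N"
    and zero_obj: "\<exists>Z. is_zero_obj C Z"
    and biproducts: "\<lbrakk>M \<in> obj C; N \<in> obj C\<rbrakk> \<Longrightarrow> \<exists>S i j p q. is_biproduct C M N S i j p q"
    and kernels: "\<lbrakk>M \<in> obj C; N \<in> obj C; f \<in> mor C M N\<rbrakk>
      \<Longrightarrow> \<exists>K. carrier K = {x \<in> carrier M. f x = \<zero>\<^bsub>N\<^esub>} \<and>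
              is_kernel C M N f K (\<lambda>x\<in>carrier K. x)"
    and cokernels: "\<lbrakk>M \<in> obj C; N \<in> obj C; f \<in> mor C M N\<rbrakk>
      \<Longrightarrow> \<exists>Q q. q ` carrier N = carrier Q \<and>
                {y \<in> carrier N. q y = \<zero>\<^bsub>Q\<^esub>} = f ` carrier M \<and>
                is_cokernel C M N f Q q"
    and mono_normal: "\<lbrakk>M \<in> obj C; N \<in> obj C; is_mono C M N f\<rbrakk>
      \<Longrightarrow> \<exists>L\<in>obj C. \<exists>g\<in>mor C N L. is_kernel C N L g M f"
    and epi_normal: "\<lbrakk>M \<in> obj C; N \<in> obj C; is_epi C M N f\<rbrakk>
      \<Longrightarrow> \<exists>L\<in>obj C. \<exists>g\<in>mor C L M. is_cokernel C L M g N f"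

definition injective_obj :: "('r, 'm, 'z) modcat \<Rightarrow> ('r, 'm, 'z) module_scheme \<Rightarrow> bool" where
  "injective_obj C E \<longleftrightarrow> E \<in> obj C \<and>
     (\<forall>X\<in>obj C. \<forall>Y\<in>obj C. \<forall>m. is_mono C X Y m \<longrightarrow>
        (\<forall>f\<in>mor C X E. \<exists>g\<in>mor C Y E. compose (carrier X) g m = f))"

definition enough_injectives :: "('r, 'm, 'z) modcat \<Rightarrow> bool" where
  "enough_injectives C \<longleftrightarrow> (\<forall>M\<in>obj C. \<exists>E i. injective_obj C E \<and> is_mono C M E i)"

definition injection ::
  "('r, 'm, 'z) modcat \<Rightarrow> ('r, 'm, 'z) module_scheme \<Rightarrow> ('r, 'm, 'z) module_scheme
    \<Rightarrow> ('m \<Rightarrow> 'm) \<Rightarrow> bool" where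
  "injection C M N f \<longleftrightarrow> f \<in> mor C M N \<and> inj_on f (carrier M)"

text \<open>
  \<open>N \<subseteq> M\<close> for objects of the category: the inclusion of the carriers is a morphism.  As
  morphisms are linear, this makes the operations of \<open>N\<close> the restrictions of those of
  \<open>M\<close>.
\<close>

definition included ::
  "('r, 'm, 'z) modcat \<Rightarrow> ('r, 'm, 'z) module_scheme \<Rightarrow> ('r, 'm, 'z) module_scheme \<Rightarrow> bool" where
  "included C N M \<longleftrightarrow> N \<in> obj C \<and> M \<in> obj C \<and> carrier N \<subseteq> carrier M \<and>
     (\<lambda>x\<in>carrier N. x) \<in> mor C N M"

section \<open>Pairs of modules and pair operations\<close>

text \<open>
  A pair \<open>L \<subseteq> M\<close> is represented by the object \<open>M\<close> together with the underlying set of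
  the submodule \<open>L\<close>.  Nothing is lost: two objects included in \<open>M\<close> with the same
  carrier are isomorphic by the identity map.
\<close>

type_synonym ('r, 'm, 'z) mod_pair = "'m set \<times> ('r, 'm, 'z) module_scheme"

definition is_pair :: "('r, 'm, 'z) modcat \<Rightarrow> ('r, 'm, 'z) mod_pair \<Rightarrow> bool" where
  "is_pair C = (\<lambda>(L, M). \<exists>N. included C N M \<and> carrier N = L)"

definition iso_closed :: "('r, 'm, 'z) modcat \<Rightarrow> ('r, 'm, 'z) mod_pair set \<Rightarrow> bool" where
  "iso_closed C Q \<longleftrightarrow> (\<forall>(L, M)\<in>Q. \<forall>M'\<in>obj C. \<forall>\<phi>. is_iso C M M' \<phi> \<longrightarrow> (\<phi> ` L, M') \<in> Q)"

locale injective_pair_classes =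
  fixes C :: "('r, 'm, 'z) modcat" and P P' :: "('r, 'm, 'z) mod_pair set"
  assumes P_pair: "(L, E) \<in> P \<Longrightarrow> is_pair C (L, E) \<and> injective_obj C E"
    and P'_pair: "(A, B) \<in> P' \<Longrightarrow> is_pair C (A, B)"
    and P_subset: "P \<subseteq> P'"
    and embed: "(A, B) \<in> P' \<Longrightarrow>
      \<exists>E i. injective_obj C E \<and> injection C B E i \<and> (i ` A, E) \<in> P"
    and embed2: "\<lbrakk>(A, B) \<in> P'; (D, B) \<in> P'; A \<subseteq> D\<rbrakk> \<Longrightarrow>
      \<exists>E i. injective_obj C E \<and> injection C B E i \<and> (i ` A, E) \<in> P \<and> (i ` D, E) \<in> P"
    and preimage: "\<lbrakk>(A, B) \<in> P'; injective_obj C E; injection C B E i; (i ` A, E) \<in> P;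
        G \<in> obj C; injection C B G \<psi>;
        injective_obj C F; injection C G F j; (j ` \<psi> ` A, F) \<in> P;
        \<psi>' \<in> mor C E F; compose (carrier B) \<psi>' i = compose (carrier B) j \<psi>\<rbrakk> \<Longrightarrow>
      ({e \<in> carrier E. \<psi>' e \<in> j ` \<psi> ` A}, E) \<in> P"
    and P_iso_closed: "iso_closed C P"
    and P'_iso_closed: "iso_closed C P'"

text \<open>
  A pair operation is a total HOL function whose values matter only on the pairs of the class
  \<open>Q\<close>.
\<close>

type_synonym ('r, 'm, 'z) pair_op = "'m set \<Rightarrow> ('r, 'm, 'z) module_scheme \<Rightarrow> 'm set"

definition pair_operation ::
  "('r, 's) ring_scheme \<Rightarrow> ('r, 'm, 'z) modcat \<Rightarrow> ('r, 'm, 'z) mod_pair set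
    \<Rightarrow> ('r, 'm, 'z) pair_op \<Rightarrow> bool" where
  "pair_operation R C Q p \<longleftrightarrow>
     (\<forall>(L, M)\<in>Q. submodule (p L M) R M \<and>
        (\<forall>M'\<in>obj C. \<forall>\<phi>. is_iso C M M' \<phi> \<longrightarrow> \<phi> ` p L M = p (\<phi> ` L) M'))"

definition functorial ::
  "('r, 'm, 'z) modcat \<Rightarrow> ('r, 'm, 'z) mod_pair set \<Rightarrow> ('r, 'm, 'z) pair_op \<Rightarrow> bool" where
  "functorial C Q p \<longleftrightarrow>
     (\<forall>(L, M)\<in>Q. \<forall>M'\<in>obj C. \<forall>g\<in>mor C M M'.
        (g ` L, M') \<in> Q \<longrightarrow> g ` p L M \<subseteq> p (g ` L) M')"

definition hereditary ::
  "('r, 'm, 'z) modcat \<Rightarrow> ('r, 'm, 'z) mod_pair set \<Rightarrow> ('r, 'm, 'z) pair_op \<Rightarrow> bool" where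
  "hereditary C Q p \<longleftrightarrow>
     (\<forall>L N M. L \<subseteq> carrier N \<longrightarrow> included C N M \<longrightarrow> (L, M) \<in> Q \<longrightarrow> (L, N) \<in> Q \<longrightarrow>
        p L N = p L M \<inter> carrier N)"

definition admissible_mono ::
  "('r, 'm, 'z) modcat \<Rightarrow> ('r, 'm, 'z) mod_pair set \<Rightarrow> 'm set \<Rightarrow> ('r, 'm, 'z) module_scheme
    \<Rightarrow> ('r, 'm, 'z) module_scheme \<Rightarrow> ('m \<Rightarrow> 'm) \<Rightarrow> bool" where
  "admissible_mono C P A B E i \<longleftrightarrow>
     injective_obj C E \<and> is_mono C B E i \<and> (i ` A, E) \<in> P"

definition pullback_op ::
  "('r, 'm, 'z) pair_op \<Rightarrow> 'm set \<Rightarrow> ('r, 'm, 'z) module_scheme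
    \<Rightarrow> ('r, 'm, 'z) module_scheme \<Rightarrow> ('m \<Rightarrow> 'm) \<Rightarrow> 'm set" where
  "pullback_op p A B E i = {b \<in> carrier B. i b \<in> p (i ` A) E}"

text \<open>The value for an arbitrarily chosen admissible monomorphism.\<close>

definition p_h ::
  "('r, 'm, 'z) modcat \<Rightarrow> ('r, 'm, 'z) mod_pair set \<Rightarrow> ('r, 'm, 'z) pair_op
    \<Rightarrow> ('r, 'm, 'z) pair_op" where
  "p_h C P p A B =
     (let (E, i) = (SOME (E, i). admissible_mono C P A B E i) in pullback_op p A B E i)"

end

theory Submission
  imports Defs "HOL-Algebra.Coset"
begin

text \<open>
  If \<open>i: B \<rightarrow> E\<close> and \<open>j: B' \<rightarrow> F\<close> are admissible for \<open>(A, B)\<close> and \<open>(g(A), B')\<close>, then injectivity of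
  \<open>F\<close> extends \<open>j \<circ> g\<close> along \<open>i\<close> to some \<open>\<psi>: E \<rightarrow> F\<close>, and functoriality of \<open>p\<close> at \<open>\<psi>\<close> gives
  \<open>g(i\<inverse>(p(i(A), E))) \<subseteq> j\<inverse>(p(j(g(A)), F))\<close>.  For \<open>g = id\<close> this is independence of the choice, in
  general it is functoriality.  Heredity holds because the restriction to \<open>N \<subseteq> M\<close> of an admissible
  map for \<open>(L, M)\<close> is admissible for \<open>(L, N)\<close>.  If \<open>p\<close> is already hereditary on \<open>\<P>'\<close>, compare
  \<open>B\<close> with its image \<open>i(B) \<subseteq> E\<close>, to which it is isomorphic in the category.
\<close>

section \<open>Morphisms of a module category as linear maps\<close>

context module_category
begin

text \<open>Viewed on additive groups, morphisms inherit the facts about \<open>group_hom\<close>,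
  notably that a trivial kernel forces injectivity.\<close>

lemma linear_map_group_hom:
  assumes "M \<in> obj C" "N \<in> obj C" "f \<in> mor C M N"
  shows "group_hom (add_monoid M) (add_monoid N) f"
proof -
  interpret M: module R M using assms obj_module by blast
  interpret N: module R N using assms obj_module by blast
  have "f \<in> hom (add_monoid M) (add_monoid N)"
    using assms mor_linear[of M N] by (auto simp: hom_def linear_maps_def)
  then show ?thesis
    by (intro group_hom.intro group_hom_axioms.intro M.add.group_axioms N.add.group_axioms)
qed

lemma mor_PiE:
  assumes "M \<in> obj C" "N \<in> obj C" "f \<in> mor C M N"
  shows "f \<in> carrier M \<rightarrow>\<^sub>E carrier N"
  using assms mor_linear[of M N] by (auto simp: linear_maps_def)

lemma mor_closed:
  assumes "M \<in> obj C" "N \<in> obj C" "f \<in> mor C M N" "x \<in> carrier M"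
  shows "f x \<in> carrier N"
  using mor_PiE[OF assms(1-3)] assms(4) by auto

lemma mor_eqI:
  assumes "M \<in> obj C" "N \<in> obj C" "f \<in> mor C M N" "g \<in> mor C M N"
    and "\<And>x. x \<in> carrier M \<Longrightarrow> f x = g x"
  shows "f = g"
  using mor_PiE[of M N f] mor_PiE[of M N g] assms by (blast intro: PiE_ext)

lemma submodule_vimage:
  assumes "M \<in> obj C" "N \<in> obj C" "f \<in> mor C M N" "submodule H R N"
  shows "submodule {x \<in> carrier M. f x \<in> H} R M"
proof -
  interpret M: module R M using assms obj_module by blast
  interpret N: module R N using assms obj_module by blast
  interpret h: group_hom "add_monoid M" "add_monoid N" f
    using linear_map_group_hom[OF assms(1-3)] .
  interpret H: submodule H R N by fact
  have scal: "f (r \<odot>\<^bsub>M\<^esub> x) = r \<odot>\<^bsub>N\<^esub> f x" if "r \<in> carrier R" "x \<in> carrier M" for r x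
    using assms mor_linear[of M N] that by (auto simp: linear_maps_def)
  show ?thesis
  proof (rule M.submoduleI)
    show "\<zero>\<^bsub>M\<^esub> \<in> {x \<in> carrier M. f x \<in> H}"
      using h.hom_one H.one_closed by simp
    show "\<ominus>\<^bsub>M\<^esub> a \<in> {x \<in> carrier M. f x \<in> H}" if "a \<in> {x \<in> carrier M. f x \<in> H}" for a
      using that h.hom_inv[of a] H.m_inv_closed[of "f a"] by (simp add: a_inv_def)
    show "a \<oplus>\<^bsub>M\<^esub> b \<in> {x \<in> carrier M. f x \<in> H}"
      if "a \<in> {x \<in> carrier M. f x \<in> H}" "b \<in> {x \<in> carrier M. f x \<in> H}" for a b
      using that h.hom_mult[of a b] H.m_closed[of "f a" "f b"] by simp
  qed (auto simp: scal)
qed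

text \<open>The embedding axioms supply injections, whereas \<open>injective_obj\<close> and
  \<open>admissible_mono\<close> are phrased with \<open>is_mono\<close>. \<open>mono_inj_on\<close>
  goes back.\<close>

lemma injection_is_mono:
  assumes "M \<in> obj C" "N \<in> obj C" "injection C M N f"
  shows "is_mono C M N f"
  unfolding is_mono_def
proof (intro conjI ballI impI)
  show "f \<in> mor C M N" using assms by (simp add: injection_def)
  fix X g h
  assume X: "X \<in> obj C" and gh: "g \<in> mor C X M" "h \<in> mor C X M"
    and eq: "compose (carrier X) f g = compose (carrier X) f h"
  show "g = h"
  proof (rule mor_eqI[OF X assms(1) gh])
    fix x assume x: "x \<in> carrier X"
    then have "f (g x) = f (h x)" using eq by (metis compose_eq)
    then show "g x = h x"
      using assms(3) x mor_closed[OF X assms(1)] gh by (auto simp: injection_def inj_on_def)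
  qed
qed

lemma iso_inverse:
  assumes "M \<in> obj C" "N \<in> obj C" "is_iso C M N f"
  obtains g where "g \<in> mor C N M"
    and "\<And>x. x \<in> carrier M \<Longrightarrow> g (f x) = x" and "\<And>y. y \<in> carrier N \<Longrightarrow> f (g y) = y"
proof -
  from assms(3) obtain g where g: "g \<in> mor C N M"
    "compose (carrier M) g f = (\<lambda>x\<in>carrier M. x)"
    "compose (carrier N) f g = (\<lambda>x\<in>carrier N. x)"
    unfolding is_iso_def by blast
  show ?thesis
    using that[OF g(1)] g(2,3) by (metis compose_eq restrict_apply')
qed

lemma is_isoI:
  assumes "M \<in> obj C" "N \<in> obj C" "f \<in> mor C M N" "g \<in> mor C N M"
    and "\<And>x. x \<in> carrier M \<Longrightarrow> g (f x) = x" and "\<And>y. y \<in> carrier N \<Longrightarrow> f (g y) = y"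
  shows "is_iso C M N f"
  using assms unfolding is_iso_def by (auto simp: compose_def cong: restrict_cong intro!: bexI[of _ g])

end

section \<open>Monomorphisms and their images\<close>

context abelian_module_category
begin

text \<open>The inclusion of the kernel and the zero map agree after composition with
  \<open>f\<close>, so a monomorphism makes them equal. The kernel is carried by all elements that
  \<open>f\<close> kills, hence these are all zero.\<close>

lemma mono_inj_on:
  assumes M: "M \<in> obj C" and N: "N \<in> obj C" and f: "is_mono C M N f"
  shows "inj_on f (carrier M)"
proof -
  have fm: "f \<in> mor C M N" using f by (simp add: is_mono_def)
  interpret h: group_hom "add_monoid M" "add_monoid N" f
    using linear_map_group_hom[OF M N fm] .
  obtain K where K: "carrier K = {x \<in> carrier M. f x = \<zero>\<^bsub>N\<^esub>}"
    "is_kernel C M N f K (\<lambda>x\<in>carrier K. x)"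
    using kernels[OF M N fm] by blast
  let ?k = "\<lambda>x\<in>carrier K. x"
  have KO: "K \<in> obj C" and km: "?k \<in> mor C K M"
    and fk: "compose (carrier K) f ?k = zero_map K N"
    using K(2) by (auto simp: is_kernel_def)
  have zk: "zero_map K M \<in> mor C K M" using zero_mor[OF KO M] .
  have "compose (carrier K) f (zero_map K M) = zero_map K N"
    using h.hom_one by (auto simp: compose_def zero_map_def fun_eq_iff)
  then have "?k = zero_map K M"
    using f KO km zk fk unfolding is_mono_def by metis
  then have "x = \<zero>\<^bsub>M\<^esub>" if "x \<in> carrier M" "f x = \<zero>\<^bsub>N\<^esub>" for x
    using that K(1) unfolding zero_map_def by (metis (mono_tags, lifting) mem_Collect_eq restrict_apply')
  then show ?thesis
    using h.inj_on_one_iff by simp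
qed

text \<open>The category need not be full, so a linear bijection of \<open>B\<close> onto the image
  is not yet an isomorphism in it. The image becomes an object as the kernel of the cokernel of
  \<open>i\<close>; universal properties then give morphisms both ways.\<close>

lemma mono_image:
  assumes B: "B \<in> obj C" and E: "E \<in> obj C" and i: "is_mono C B E i"
  obtains N u where "included C N E" "carrier N = i ` carrier B" "is_iso C B N u"
    "\<And>b. b \<in> carrier B \<Longrightarrow> u b = i b"
proof -
  have im: "i \<in> mor C B E" using i by (simp add: is_mono_def)
  obtain Q q where q: "{y \<in> carrier E. q y = \<zero>\<^bsub>Q\<^esub>} = i ` carrier B"
    "is_cokernel C B E i Q q"
    using cokernels[OF B E im] by blast
  have Q: "Q \<in> obj C" and qm: "q \<in> mor C E Q"
    and qi: "compose (carrier B) q i = zero_map B Q"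
    using q(2) by (auto simp: is_cokernel_def)
  obtain N where N: "carrier N = {x \<in> carrier E. q x = \<zero>\<^bsub>Q\<^esub>}"
    "is_kernel C E Q q N (\<lambda>x\<in>carrier N. x)"
    using kernels[OF E Q qm] by blast
  let ?k = "\<lambda>x\<in>carrier N. x"
  have NO: "N \<in> obj C" and km: "?k \<in> mor C N E"
    using N(2) by (auto simp: is_kernel_def)
  have NB: "carrier N = i ` carrier B" using N(1) q(1) by simp
  have inc: "included C N E"
    using NO E km N(1) by (auto simp: included_def)
  \<comment> \<open>The cokernel map \<open>q\<close> kills \<open>i\<close>, so \<open>i\<close>
    factors through the kernel \<open>N\<close> of \<open>q\<close>.\<close>
  obtain u where um: "u \<in> mor C B N" and ku: "compose (carrier B) ?k u = i"
    using N(2) B im qi unfolding is_kernel_def by blast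
  have u: "u b = i b" if "b \<in> carrier B" for b
    using ku that mor_closed[OF B NO um that] by (metis compose_eq restrict_apply')
  obtain L g where L: "L \<in> obj C" and gm: "g \<in> mor C E L" and ig: "is_kernel C E L g B i"
    using mono_normal[OF B E i] by blast
  have gi: "g (i b) = \<zero>\<^bsub>L\<^esub>" if "b \<in> carrier B" for b
    using ig that unfolding is_kernel_def zero_map_def by (metis compose_eq restrict_apply')
  have "compose (carrier N) g ?k = zero_map N L"
    using gi NB by (auto simp: compose_def zero_map_def fun_eq_iff)
  then obtain v where vm: "v \<in> mor C N B" and iv: "compose (carrier N) i v = ?k"
    using ig NO km unfolding is_kernel_def by blast
  have v: "i (v y) = y" if "y \<in> carrier N" for y
    using iv that by (metis compose_eq restrict_apply')
  have "is_iso C B N u"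
  proof (rule is_isoI[OF B NO um vm])
    show "u (v y) = y" if "y \<in> carrier N" for y
      using that u v mor_closed[OF NO B vm] by simp
    show "v (u x) = x" if "x \<in> carrier B" for x
    proof (rule inj_onD[OF mono_inj_on[OF B E i]])
      have "u x \<in> carrier N" using mor_closed[OF B NO um that] .
      then show "i (v (u x)) = i x" "v (u x) \<in> carrier B"
        using v u that mor_closed[OF NO B vm] by auto
    qed fact
  qed
  then show ?thesis using that inc NB u by blast
qed

end

section \<open>Independence of the admissible monomorphism\<close>

locale injective_pair_setting =
  abelian_module_category R C + injective_pair_classes C P P'
  for R :: "('r, 's) ring_scheme" and C :: "('r, 'm, 'z) modcat" and P P'
begin

lemma pair_obj:
  assumes "(A, B) \<in> P'"
  shows "B \<in> obj C" "A \<subseteq> carrier B"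
  using P'_pair[OF assms] by (auto simp: is_pair_def included_def)

lemma admissible_monoE:
  assumes "(A, B) \<in> P'" "admissible_mono C P A B E i"
  shows "injective_obj C E" "E \<in> obj C" "is_mono C B E i" "i \<in> mor C B E" "(i ` A, E) \<in> P"
  using assms by (auto simp: admissible_mono_def injective_obj_def is_mono_def)

lemma admissible_mono_exists:
  assumes "(A, B) \<in> P'"
  shows "\<exists>E i. admissible_mono C P A B E i"
  using embed[OF assms] injection_is_mono[of B] pair_obj[OF assms]
  unfolding admissible_mono_def injective_obj_def by blast

lemma admissible_mono_extends:
  assumes AB: "(A, B) \<in> P'" and i: "admissible_mono C P A B E i"
    and F: "injective_obj C F" and f: "f \<in> mor C B F"
  obtains h where "h \<in> mor C E F" "\<And>b. b \<in> carrier B \<Longrightarrow> h (i b) = f b"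
proof -
  note iE = admissible_monoE[OF AB i]
  obtain h where "h \<in> mor C E F" "compose (carrier B) h i = f"
    using F f iE(2,3) pair_obj[OF AB] unfolding injective_obj_def by blast
  then show ?thesis using that compose_eq by metis
qed

lemma pullback_op_functorial:
  assumes p: "functorial C P p"
    and AB: "(A, B) \<in> P'" and B': "(g ` A, B') \<in> P'" and g: "g \<in> mor C B B'"
    and i: "admissible_mono C P A B E i" and j: "admissible_mono C P (g ` A) B' F j"
  shows "g ` pullback_op p A B E i \<subseteq> pullback_op p (g ` A) B' F j"
proof -
  note B = pair_obj[OF AB] and B'o = pair_obj[OF B']
  note iE = admissible_monoE[OF AB i] and jF = admissible_monoE[OF B' j]
  have "compose (carrier B) j g \<in> mor C B F"
    using comp_mor[OF B(1) B'o(1) jF(2) g jF(4)] .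
  then obtain h where h: "h \<in> mor C E F"
    and "\<And>b. b \<in> carrier B \<Longrightarrow> h (i b) = compose (carrier B) j g b"
    using admissible_mono_extends[OF AB i jF(1)] by blast
  then have hi: "h (i b) = j (g b)" if "b \<in> carrier B" for b
    using that by (simp add: compose_eq)
  \<comment> \<open>Functoriality of \<open>p\<close> at \<open>h\<close> requires the image pair to
    lie in \<open>P\<close>; this equation identifies it with the pair that \<open>j\<close>
    provides.\<close>
  have im: "h ` i ` A = j ` g ` A"
    using hi B(2) by (force simp: image_image)
  have "h ` p (i ` A) E \<subseteq> p (j ` g ` A) F"
    using p iE(5) jF(2,5) h im unfolding functorial_def by fastforce
  then show ?thesis
    using hi mor_closed[OF B(1) B'o(1) g] by (force simp: pullback_op_def)
qed

lemma pullback_op_unique: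
  assumes p: "functorial C P p" and AB: "(A, B) \<in> P'"
    and i: "admissible_mono C P A B E i" and j: "admissible_mono C P A B F j"
  shows "pullback_op p A B E i = pullback_op p A B F j"
proof -
  let ?id = "\<lambda>x\<in>carrier B. x"
  note B = pair_obj[OF AB]
  have A: "?id ` A = A" using B(2) by auto
  \<comment> \<open>Stated for arbitrary admissible maps so that both inclusions follow by
    exchanging their roles.\<close>
  have le: "pullback_op p A B E i \<subseteq> pullback_op p A B F j"
    if "admissible_mono C P A B E i" "admissible_mono C P A B F j" for E i F j
    using pullback_op_functorial[OF p AB _ id_mor[OF B(1)] that(1), of F j] A AB that(2)
    by (force simp: pullback_op_def)
  from le[OF i j] le[OF j i] show ?thesis by blast
qed

lemma p_h_choice:
  assumes "(A, B) \<in> P'"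
  obtains E i where "admissible_mono C P A B E i" "p_h C P p A B = pullback_op p A B E i"
proof -
  have "\<exists>x. (\<lambda>(E, i). admissible_mono C P A B E i) x"
    using admissible_mono_exists[OF assms] by auto
  then have "(\<lambda>(E, i). admissible_mono C P A B E i) (SOME (E, i). admissible_mono C P A B E i)"
    by (rule someI_ex)
  then show ?thesis
    using that by (auto simp: p_h_def Let_def split: prod.splits)
qed

lemma p_h_eq_pullback_op:
  assumes "functorial C P p" "(A, B) \<in> P'" "admissible_mono C P A B E i"
  shows "p_h C P p A B = pullback_op p A B E i"
  using p_h_choice[OF assms(2)] pullback_op_unique[OF assms(1,2) _ assms(3)] by metis

lemma p_h_included:
  assumes p: "functorial C P p" and AB: "(A, B) \<in> P'"
    and E: "injective_obj C E" "included C B E" "(A, E) \<in> P"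
  shows "p_h C P p A B = p A E \<inter> carrier B"
proof -
  let ?i = "\<lambda>x\<in>carrier B. x"
  note B = pair_obj[OF AB]
  have A: "?i ` A = A" using B(2) by auto
  have "injection C B E ?i" using E(2) by (auto simp: injection_def included_def inj_on_def)
  then have "admissible_mono C P A B E ?i"
    using E A B(1) injection_is_mono by (auto simp: admissible_mono_def injective_obj_def)
  from p_h_eq_pullback_op[OF p AB this] show ?thesis
    using A by (auto simp: pullback_op_def)
qed

section \<open>Functoriality, invariance and heredity of \<open>p_h\<close>\<close>

lemma p_h_functorial:
  assumes "functorial C P p"
  shows "functorial C P' (p_h C P p)"
  unfolding functorial_def
proof (intro ballI impI, clarify)
  fix A B B' g x
  assume AB: "(A, B) \<in> P'" "(g ` A, B') \<in> P'" and g: "g \<in> mor C B B'"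
    and x: "x \<in> p_h C P p A B"
  obtain E i F j where "admissible_mono C P A B E i" "admissible_mono C P (g ` A) B' F j"
    using admissible_mono_exists AB by meson
  then show "g x \<in> p_h C P p (g ` A) B'"
    using pullback_op_functorial[OF assms AB g, of E i F j]
      p_h_eq_pullback_op[OF assms AB(1)] p_h_eq_pullback_op[OF assms AB(2)] x by blast
qed

text \<open>The submodule property is that of a preimage. Invariance follows from functoriality of
  \<open>p_h\<close> at the isomorphism and at its inverse, each giving one inclusion.\<close>

lemma p_h_pair_operation:
  assumes op: "pair_operation R C P p" and p: "functorial C P p"
  shows "pair_operation R C P' (p_h C P p)"
  unfolding pair_operation_def
proof (intro ballI, clarify, intro conjI ballI allI impI)
  fix A B assume AB: "(A, B) \<in> P'"
  note B = pair_obj[OF AB]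
  obtain E i where i: "admissible_mono C P A B E i" "p_h C P p A B = pullback_op p A B E i"
    using p_h_choice[OF AB] .
  note iE = admissible_monoE[OF AB i(1)]
  have "submodule (p (i ` A) E) R E"
    using op iE(5) by (auto simp: pair_operation_def)
  from submodule_vimage[OF B(1) iE(2,4) this]
  show sub: "submodule (p_h C P p A B) R B" by (simp add: i(2) pullback_op_def)
  fix B' \<phi> assume B': "B' \<in> obj C" and iso: "is_iso C B B' \<phi>"
  have \<phi>: "\<phi> \<in> mor C B B'" using iso by (simp add: is_iso_def)
  obtain \<theta> where \<theta>: "\<theta> \<in> mor C B' B" "\<And>x. x \<in> carrier B \<Longrightarrow> \<theta> (\<phi> x) = x"
    "\<And>y. y \<in> carrier B' \<Longrightarrow> \<phi> (\<theta> y) = y"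
    using iso_inverse[OF B(1) B' iso] by blast
  have AB': "(\<phi> ` A, B') \<in> P'"
    using P'_iso_closed AB B' iso unfolding iso_closed_def by blast
  have A: "\<theta> ` \<phi> ` A = A" using \<theta>(2) B(2) by (force simp: image_image)
  have "\<phi> ` p_h C P p A B \<subseteq> p_h C P p (\<phi> ` A) B'"
    using p_h_functorial[OF p] AB AB' B' \<phi> unfolding functorial_def by blast
  moreover have "\<theta> ` p_h C P p (\<phi> ` A) B' \<subseteq> p_h C P p A B"
    using p_h_functorial[OF p] AB AB' B(1) \<theta>(1) A unfolding functorial_def by fastforce
  moreover have "p_h C P p (\<phi> ` A) B' \<subseteq> carrier B'"
    using p_h_choice[OF AB', of p] by (auto simp: pullback_op_def)
  ultimately show "\<phi> ` p_h C P p A B = p_h C P p (\<phi> ` A) B'"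
    using \<theta>(3) by (auto simp: subset_iff image_iff) metis
qed

lemma p_h_hereditary:
  assumes p: "functorial C P p"
  shows "hereditary C P' (p_h C P p)"
  unfolding hereditary_def
proof (intro allI impI)
  fix L N M
  assume L: "L \<subseteq> carrier N" and N: "included C N M" and LM: "(L, M) \<in> P'" and LN: "(L, N) \<in> P'"
  note M = pair_obj[OF LM]
  obtain E i where i: "admissible_mono C P L M E i" "p_h C P p L M = pullback_op p L M E i"
    using p_h_choice[OF LM] .
  note iE = admissible_monoE[OF LM i(1)]
  have NM: "N \<in> obj C" "carrier N \<subseteq> carrier M" "(\<lambda>x\<in>carrier N. x) \<in> mor C N M"
    using N by (auto simp: included_def)
  \<comment> \<open>Morphisms are extensional, so the restriction of \<open>i\<close> is formed by
    composing with the inclusion of \<open>N\<close>.\<close>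
  let ?j = "compose (carrier N) i (\<lambda>x\<in>carrier N. x)"
  have j: "?j x = i x" if "x \<in> carrier N" for x using that by (simp add: compose_eq)
  have "inj_on ?j (carrier N)"
    using inj_on_subset[OF mono_inj_on[OF M(1) iE(2,3)] NM(2)] j by (simp cong: inj_on_cong)
  then have "is_mono C N E ?j"
    using injection_is_mono[OF NM(1) iE(2)] comp_mor[OF NM(1) M(1) iE(2) NM(3) iE(4)]
    by (simp add: injection_def)
  moreover have jL: "?j ` L = i ` L" using j L by (auto simp: image_iff subset_iff)
  ultimately have "admissible_mono C P L N E ?j"
    using iE by (simp add: admissible_mono_def)
  from p_h_eq_pullback_op[OF p LN this]
  show "p_h C P p L N = p_h C P p L M \<inter> carrier N"
    using i(2) jL j NM(2) by (auto simp: pullback_op_def)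
qed

text \<open>The isomorphism of \<open>B\<close> with its image \<open>N\<close> turns
  \<open>p A B\<close> into \<open>p (i\<close> A) N\<open>, which heredity cuts out of\<close>p (i
  \<open>A) E\<close>; pulling back along the injective \<open>i\<close> recovers
  \<open>p A B\<close>. This works for whichever admissible map the choice picks.\<close>

lemma p_h_of_hereditary:
  assumes op: "pair_operation R C P' p" and her: "hereditary C P' p" and AB: "(A, B) \<in> P'"
  shows "p_h C P p A B = p A B"
proof -
  note B = pair_obj[OF AB]
  obtain E i where i: "admissible_mono C P A B E i" "p_h C P p A B = pullback_op p A B E i"
    using p_h_choice[OF AB] .
  note iE = admissible_monoE[OF AB i(1)]
  obtain N u where N: "included C N E" "carrier N = i ` carrier B" and iso: "is_iso C B N u"
    and u: "\<And>b. b \<in> carrier B \<Longrightarrow> u b = i b"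
    using mono_image[OF B(1) iE(2,3)] by blast
  have NO: "N \<in> obj C" using N(1) by (simp add: included_def)
  have uA: "u ` A = i ` A" using u B(2) by (auto simp: image_iff subset_iff)
  \<comment> \<open>Heredity compares two pairs of \<open>P'\<close>; closure under isomorphism
    brings in the pair on \<open>N\<close>.\<close>
  have AN: "(i ` A, N) \<in> P'"
    using P'_iso_closed AB NO iso uA unfolding iso_closed_def by fastforce
  have sub: "p A B \<subseteq> carrier B"
  proof -
    interpret M: module R B using obj_module[OF B(1)] .
    show ?thesis using op AB M.submoduleE(1) unfolding pair_operation_def by blast
  qed
  have "i ` p A B = u ` p A B" using u sub by (auto simp: image_iff subset_iff)
  also have "\<dots> = p (i ` A) N"
    using op AB NO iso uA unfolding pair_operation_def by fastforce
  also have "\<dots> = p (i ` A) E \<inter> carrier N"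
  proof (rule her[unfolded hereditary_def, rule_format, OF _ N(1) _ AN])
    show "i ` A \<subseteq> carrier N" using N(2) B(2) by blast
    show "(i ` A, E) \<in> P'" using iE(5) P_subset by blast
  qed
  finally have "i ` p A B = p (i ` A) E \<inter> i ` carrier B" using N(2) by simp
  then have "pullback_op p A B E i = {b \<in> carrier B. i b \<in> i ` p A B}"
    by (auto simp: pullback_op_def)
  \<comment> \<open>As \<open>i\<close> is injective on \<open>carrier B\<close> and
    \<open>p A B\<close> lies there, taking the preimage of the image adds nothing.\<close>
  also have "\<dots> = p A B"
    using inj_on_image_mem_iff[OF mono_inj_on[OF B(1) iE(2,3)] _ sub] sub by blast
  finally show ?thesis using i(2) by simp
qed

end

theorem proposition5p3:
  fixes R :: "('r, 's) ring_scheme"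
    and C :: "('r, 'm, 'z) modcat"
    and P P' :: "('r, 'm, 'z) mod_pair set"
    and p :: "('r, 'm, 'z) pair_op"
  assumes "abelian_module_category R C"
    and "enough_injectives C"
    and "injective_pair_classes C P P'"
  shows "(pair_operation R C P p \<and> functorial C P p \<longrightarrow>
      (\<forall>(A, B)\<in>P'.
         (\<exists>E i. admissible_mono C P A B E i) \<and>
         (\<forall>E i. admissible_mono C P A B E i \<longrightarrow> p_h C P p A B = pullback_op p A B E i) \<and>
         (\<forall>E. injective_obj C E \<and> included C B E \<and> (A, E) \<in> P \<longrightarrow>
            p_h C P p A B = p A E \<inter> carrier B)) \<and>
      pair_operation R C P' (p_h C P p) \<and>
      functorial C P' (p_h C P p) \<and>
      hereditary C P' (p_h C P p)) \<and>
    (pair_operation R C P' p \<and> functorial C P' p \<and> hereditary C P' p \<longrightarrow>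
      (\<forall>(A, B)\<in>P'. p_h C P p A B = p A B))"
proof -
  interpret injective_pair_setting R C P P'
    using assms(1,3) by (rule injective_pair_setting.intro)
  show ?thesis
    using admissible_mono_exists p_h_eq_pullback_op[of p] p_h_included[of p]
      p_h_pair_operation[of p] p_h_functorial[of p] p_h_hereditary[of p] p_h_of_hereditary[of p]
    by (intro conjI impI ballI; clarsimp)
qed

end
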